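(* Let $\alpha\in\mathbb{R}/\mathbb{Z}$ be irrational with partial quotients $\{a_n\}$ and convergent denominators $\{q_n\}$. For $n\ge1$, the index $q_n$ is present if and only if $a_{n+1}\ge2$ or the triple $(n-1,n,n+1)$ is fair.
   Context: Identify $\alpha$ with its representative in $(0,1)$ and write $\alpha=[a_1,a_2,a_3,\ldots]=1/(a_1+1/(a_2+\cdots))$ with integers $a_n\ge1$. The convergent denominators are $q_0=1$, $q_1=a_1$, $q_n=a_nq_{n-1}+q_{n-2}$ for $n\ge2$. Fix $\varepsilon>0$ not exceeding the Margulis constant of $\mathbb{H}^4$, put $c(\varepsilon)=1/\sqrt{2\cosh(\varepsilon)-2}$, and let $$u_j(r)=c(\varepsilon)\sqrt{4\sin^2(\pi j\alpha)\,r^2+j^2},\qquad \mathscr{B}(r)=\inf_{j\ge1}u_j(r)\qquad(r\ge0,\ j\ge1).$$ An integer $j\ge1$ is present if $u_j=\mathscr{B}$ on some non-empty open interval; otherwise it is absent. Let $\delta_n=4\sin^2(\pi q_n\alpha)$. For $0\le n<m$ with $q_n<q_m$, let $r_{n,m}>0$ be the first coordinate of the unique intersection point of the graphs of $u_{q_n}$ and $u_{q_m}$, so that $r_{n,m}^2=(q_m^2-q_n^2)/(\delta_n-\delta_m)$. In the remaining case $n=0$, $m=1$, $1/2<\alpha<1$ (where $q_0=q_1=1$) set $r_{0,1}=0$. A triple $(k,n,m)$ of integers with $0\le k<n<m$ and $q_k<q_n<q_m$ is called fair if $r_{k,n}<r_{k,m}<r_{n,m}$; by convention, when $1/2<\alpha<1$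 every triple $(0,1,m)$ with $m\ge2$ is fair. *)

theory Defs
  imports "HOL-Analysis.Analysis" "HOL-Algebra.Bij" "HOL-Algebra.Generated_Groups"
begin

text \<open>Upper half-space model of \<open>H\<^sup>4\<close> with curvature \<open>-1\<close>; the height is \<open>x $ 4\<close>.\<close>

definition hyp4 :: "(real^4) set" where
  "hyp4 = {x. 0 < x $ 4}"

definition hyp4_dist :: "real^4 \<Rightarrow> real^4 \<Rightarrow> real" where
  "hyp4_dist x y = arcosh (1 + (norm (x - y))\<^sup>2 / (2 * x $ 4 * y $ 4))"

definition hyp4_isometries :: "(real^4 \<Rightarrow> real^4) set" where
  "hyp4_isometries =
     {g \<in> Bij hyp4. \<forall>x\<in>hyp4. \<forall>y\<in>hyp4. hyp4_dist (g x) (g y) = hyp4_dist x y}"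

text \<open>
  On a group of isometries the compact-open topology is the topology of pointwise
  convergence, that is, the one induced by the product topology. Elements of \<open>Bij hyp4\<close>
  are extensional, so they lie in the topological space of the product.
\<close>

definition discrete_isometry_group :: "(real^4 \<Rightarrow> real^4) set \<Rightarrow> bool" where
  "discrete_isometry_group \<Gamma> \<longleftrightarrow>
     subgroup \<Gamma> (BijGroup hyp4) \<and> \<Gamma> \<subseteq> hyp4_isometries \<and>
     subtopology (product_topology (\<lambda>_. euclidean) hyp4) \<Gamma> = discrete_topology \<Gamma>"

primrec lower_central :: "('a, 'b) monoid_scheme \<Rightarrow> nat \<Rightarrow> 'a set" where
  "lower_central G 0 = carrier G"
| "lower_central G (Suc i) =
     generate G {x \<otimes>\<^bsub>G\<^esub> y \<otimes>\<^bsub>G\<^esub> inv\<^bsub>G\<^esub> x \<otimes>\<^bsub>G\<^esub> inv\<^bsub>G\<^esub> y | x y.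
                   x \<in> carrier G \<and> y \<in> lower_central G i}"

definition nilpotent_group :: "('a, 'b) monoid_scheme \<Rightarrow> bool" where
  "nilpotent_group G \<longleftrightarrow> group G \<and> (\<exists>i. lower_central G i = {\<one>\<^bsub>G\<^esub>})"

definition virtually_nilpotent :: "('a, 'b) monoid_scheme \<Rightarrow> bool" where
  "virtually_nilpotent G \<longleftrightarrow>
     group G \<and> (\<exists>N. subgroup N G \<and> finite (rcosets\<^bsub>G\<^esub> N) \<and> nilpotent_group (G\<lparr>carrier := N\<rparr>))"

definition margulis_number :: "real \<Rightarrow> bool" where
  "margulis_number \<mu> \<longleftrightarrow>
     0 < \<mu> \<and>
     (\<forall>\<Gamma> x. discrete_isometry_group \<Gamma> \<longrightarrow> x \<in> hyp4 \<longrightarrow>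
        virtually_nilpotent
          ((BijGroup hyp4)\<lparr>carrier :=
             generate (BijGroup hyp4) {g \<in> \<Gamma>. hyp4_dist x (g x) < \<mu>}\<rparr>))"

text \<open>
  Replacing \<open><\<close> by \<open>\<le>\<close> in \<^const>\<open>margulis_number\<close> does not change the supremum.
\<close>

definition margulis_constant :: real where
  "margulis_constant = Sup {\<mu>. margulis_number \<mu>}"

text \<open>
  \<open>cf_fin a k n\<close> is \<open>1/(a k + 1/(a (k+1) + \<dots> + 1/a (k+n-1)))\<close>. Partial quotients are
  indexed from 1, so the value \<open>a 0\<close> is never used.
\<close>

primrec cf_fin :: "(nat \<Rightarrow> nat) \<Rightarrow> nat \<Rightarrow> nat \<Rightarrow> real" where
  "cf_fin a k 0 = 0"
| "cf_fin a k (Suc n) = 1 / (real (a k) + cf_fin a (Suc k) n)"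

definition has_partial_quotients :: "real \<Rightarrow> (nat \<Rightarrow> nat) \<Rightarrow> bool" where
  "has_partial_quotients \<alpha> a \<longleftrightarrow> (\<forall>n\<ge>1. a n \<ge> 1) \<and> (\<lambda>n. cf_fin a 1 n) \<longlonglongrightarrow> \<alpha>"

fun cf_denom :: "(nat \<Rightarrow> nat) \<Rightarrow> nat \<Rightarrow> nat" where
  "cf_denom a 0 = 1"
| "cf_denom a (Suc 0) = a 1"
| "cf_denom a (Suc (Suc n)) = a (Suc (Suc n)) * cf_denom a (Suc n) + cf_denom a n"

definition c_eps :: "real \<Rightarrow> real" where
  "c_eps \<epsilon> = 1 / sqrt (2 * cosh \<epsilon> - 2)"

definition u_fun :: "real \<Rightarrow> real \<Rightarrow> nat \<Rightarrow> real \<Rightarrow> real" where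
  "u_fun \<epsilon> \<alpha> j r =
     c_eps \<epsilon> * sqrt (4 * (sin (pi * real j * \<alpha>))\<^sup>2 * r\<^sup>2 + (real j)\<^sup>2)"

definition B_fun :: "real \<Rightarrow> real \<Rightarrow> real \<Rightarrow> real" where
  "B_fun \<epsilon> \<alpha> r = (INF j\<in>{1..}. u_fun \<epsilon> \<alpha> j r)"

definition present :: "real \<Rightarrow> real \<Rightarrow> nat \<Rightarrow> bool" where
  "present \<epsilon> \<alpha> j \<longleftrightarrow>
     1 \<le> j \<and>
     (\<exists>s t. 0 \<le> s \<and> s < t \<and> (\<forall>r\<in>{s<..<t}. u_fun \<epsilon> \<alpha> j r = B_fun \<epsilon> \<alpha> r))"

text \<open>
  For irrational \<open>\<alpha>\<close> in \<open>(0,1)\<close> the denominators \<open>q\<^sub>0\<close> and \<open>q\<^sub>1\<close> agree exactly when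
  \<open>\<alpha> > 1/2\<close>, so apart from the exceptional case the intersection exists and is unique
  whenever \<open>n < m\<close>; see \<open>crossing_eq\<close>.
\<close>

definition crossing :: "real \<Rightarrow> real \<Rightarrow> (nat \<Rightarrow> nat) \<Rightarrow> nat \<Rightarrow> nat \<Rightarrow> real" where
  "crossing \<epsilon> \<alpha> a n m =
     (if n = 0 \<and> m = 1 \<and> 1/2 < \<alpha> then 0
      else (THE r. 0 < r \<and> u_fun \<epsilon> \<alpha> (cf_denom a n) r = u_fun \<epsilon> \<alpha> (cf_denom a m) r))"

definition fair :: "real \<Rightarrow> real \<Rightarrow> (nat \<Rightarrow> nat) \<Rightarrow> nat \<Rightarrow> nat \<Rightarrow> nat \<Rightarrow> bool" where
  "fair \<epsilon> \<alpha> a k n m \<longleftrightarrow>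
     (1/2 < \<alpha> \<and> k = 0 \<and> n = 1 \<and> 2 \<le> m) \<or>
     (k < n \<and> n < m \<and> cf_denom a k < cf_denom a n \<and> cf_denom a n < cf_denom a m \<and>
      crossing \<epsilon> \<alpha> a k n < crossing \<epsilon> \<alpha> a k m \<and>
      crossing \<epsilon> \<alpha> a k m < crossing \<epsilon> \<alpha> a n m)"

definition delta :: "real \<Rightarrow> (nat \<Rightarrow> nat) \<Rightarrow> nat \<Rightarrow> real" where
  "delta \<alpha> a n = 4 * (sin (pi * real (cf_denom a n) * \<alpha>))\<^sup>2"

lemma crossing_eq:
  assumes "0 < \<epsilon>" and q: "cf_denom a n < cf_denom a m" and d: "delta \<alpha> a m < delta \<alpha> a n"
    and exc: "\<not> (n = 0 \<and> m = 1 \<and> 1/2 < \<alpha>)"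
  shows "crossing \<epsilon> \<alpha> a n m =
           sqrt (((real (cf_denom a m))\<^sup>2 - (real (cf_denom a n))\<^sup>2) / (delta \<alpha> a n - delta \<alpha> a m))"
    (is "_ = sqrt ?R")
proof -
  have "1 < cosh \<epsilon>"
    using assms(1) cosh_real_ge_1[of \<epsilon>] cosh_real_one_iff[of \<epsilon>] by linarith
  then have c: "c_eps \<epsilon> > 0" by (simp add: c_eps_def)
  have "(real (cf_denom a n))\<^sup>2 < (real (cf_denom a m))\<^sup>2"
    using q by (simp add: power_strict_mono)
  then have R: "?R > 0" using d by simp
  have eq: "u_fun \<epsilon> \<alpha> (cf_denom a n) r = u_fun \<epsilon> \<alpha> (cf_denom a m) r \<longleftrightarrow> r\<^sup>2 = ?R" for r
  proof -
    have "u_fun \<epsilon> \<alpha> (cf_denom a n) r = u_fun \<epsilon> \<alpha> (cf_denom a m) r \<longleftrightarrow>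
        delta \<alpha> a n * r\<^sup>2 + (real (cf_denom a n))\<^sup>2 = delta \<alpha> a m * r\<^sup>2 + (real (cf_denom a m))\<^sup>2"
      using c by (simp add: u_fun_def delta_def)
    also have "\<dots> \<longleftrightarrow> r\<^sup>2 = ?R" using d by (auto simp: field_simps)
    finally show ?thesis .
  qed
  have "(THE r. 0 < r \<and> r\<^sup>2 = ?R) = sqrt ?R"
    using R by (intro the_equality) (auto simp del: real_sqrt_divide intro: real_sqrt_unique[symmetric])
  then show ?thesis using exc unfolding crossing_def eq by auto
qed

end

theory Submission
  imports Defs
begin

text \<open>
  In the variable \<open>s = r\<^sup>2\<close> the function \<open>(u\<^sub>j / c)\<^sup>2\<close> is the line of slope
  \<open>4 sin\<^sup>2(\<pi> j \<alpha>)\<close> and intercept \<open>j\<^sup>2\<close>, so an index is present if and only if its line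
  lies on the lower envelope of all these lines along an interval of positive \<open>s\<close>.
  By the best approximation property of convergents, the line of an index \<open>i\<close> with
  \<open>q\<^sub>m \<le> i < q\<^sub>m\<^sub>+\<^sub>1\<close> lies above the line of \<open>q\<^sub>m\<close>; hence only convergent denominators
  compete. Along these the intercepts increase and the slopes decrease to zero, except that
  \<open>q\<^sub>0 = q\<^sub>1\<close> when \<open>\<alpha> > 1/2\<close>, in which case the counting starts at 1. Thus \<open>q\<^sub>n\<close> is
  present if and only if the crossing with every earlier line lies strictly to the left of the
  crossing with every later line (\<open>presentI\<close>, \<open>presentD\<close>). A finite set of earlier lines and
  the fact that crossings with later lines tend to infinity turn these strict inequalities
  into an interval.

  It remains to see that this family of inequalities reduces to the single one between the
  two neighbours, and that it holds automatically if \<open>a\<^sub>n\<^sub>+\<^sub>1 \<ge> 2\<close>. Write \<open>\<theta>\<^sub>n\<close> for the distance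
  of \<open>q\<^sub>n \<alpha>\<close> to the numerator of its convergent, so that
  \<open>\<theta>\<^sub>n\<^sub>-\<^sub>1 = a\<^sub>n\<^sub>+\<^sub>1 \<theta>\<^sub>n + \<theta>\<^sub>n\<^sub>+\<^sub>1\<close> mirrors the recurrence of the denominators. If \<open>a\<^sub>n\<^sub>+\<^sub>1 \<ge> 2\<close>, then the
  denominator at least doubles from \<open>n\<close> to \<open>n + 1\<close> and the error at least halves from
  \<open>n - 1\<close> to \<open>n\<close>, and such a gap forces all inequalities at \<open>n\<close>
  (\<open>convex_of_large_quotient\<close>). In general, suppose the inequality for the two neighbours and
  take another pair \<open>k < n < m\<close>. If the neighbour lying between \<open>n\<close> and \<open>k\<close> (or \<open>m\<close>) is
  followed by a partial quotient of at least 2, then it is itself convexly placed and the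
  crossing with the neighbour is the tighter constraint. If that partial quotient is 1, two steps of the recurrence already
  give a gap that forces the inequality directly (\<open>convex_of_adjacent\<close>). The passage from errors
  to slopes costs only the inequalities for \<open>sin 2x\<close> and \<open>sin (3x/2)\<close> against \<open>sin x\<close>.
\<close>

section \<open>Growth of the squared sine\<close>

lemma sin_sq_mono:
  fixes x y :: real
  assumes "0 \<le> x" "x \<le> y" "y \<le> 1/2"
  shows "(sin (pi * x))\<^sup>2 \<le> (sin (pi * y))\<^sup>2"
proof -
  have y: "pi * y \<le> pi / 2" using assms(3) mult_left_mono[of y "1/2" pi] by simp
  have xy: "pi * x \<le> pi * y" using assms(2) by (simp add: mult_left_mono)
  have x: "0 \<le> pi * x" using assms(1) by simp
  have "sin (pi * x) \<le> sin (pi * y)"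
    by (rule sin_monotone_2pi_le) (use x xy y pi_gt_zero in linarith)+
  moreover have "0 \<le> sin (pi * x)"
    by (rule sin_ge_zero) (use x xy y pi_gt_zero in linarith)+
  ultimately show ?thesis by (rule power_mono)
qed

lemma sin_sq_strict_mono:
  fixes x y :: real
  assumes "0 \<le> x" "x < y" "y \<le> 1/2"
  shows "(sin (pi * x))\<^sup>2 < (sin (pi * y))\<^sup>2"
proof -
  have y: "pi * y \<le> pi / 2" using assms(3) mult_left_mono[of y "1/2" pi] by simp
  have xy: "pi * x < pi * y" using assms(2) by simp
  have x: "0 \<le> pi * x" using assms(1) by simp
  have "sin (pi * x) < sin (pi * y)"
    by (rule sin_monotone_2pi) (use x xy y pi_gt_zero in linarith)+
  moreover have "0 \<le> sin (pi * x)"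
    by (rule sin_ge_zero) (use x xy y pi_gt_zero in linarith)+
  ultimately show ?thesis by (intro power_strict_mono) auto
qed

text \<open>
  The factor 2 (instead of 4 for small arguments) is what remains of \<open>4 cos\<^sup>2(\<pi> x)\<close> at the
  extreme \<open>x = 1/4\<close>.
\<close>

lemma sin_sq_double:
  fixes x y :: real
  assumes "0 \<le> x" "2 * x \<le> y" "y \<le> 1/2"
  shows "2 * (sin (pi * x))\<^sup>2 \<le> (sin (pi * y))\<^sup>2"
proof -
  define S where "S = (sin (pi * x))\<^sup>2"
  have "S \<le> (sin (pi * (1/4)))\<^sup>2"
    unfolding S_def by (rule sin_sq_mono) (use assms in auto)
  then have S: "0 \<le> S" "S \<le> 1/2" by (auto simp: S_def sin_45 power_divide)
  have "2 * S \<le> 4 * S * (1 - S)" using S mult_left_mono[of S "1/2" S] by (simp add: algebra_simps)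
  also have "\<dots> = (sin (pi * (2 * x)))\<^sup>2"
    using sin_double[of "pi * x"] by (simp add: S_def cos_squared_eq power_mult_distrib ac_simps)
  also have "\<dots> \<le> (sin (pi * y))\<^sup>2"
    by (rule sin_sq_mono) (use assms in auto)
  finally show ?thesis unfolding S_def .
qed

text \<open>
  The constant \<open>4/3\<close> is attained at \<open>x = 1/3\<close>, \<open>y = 1/2\<close>. For \<open>y = 3 x / 2\<close>, in terms of the
  half angle \<open>w = \<pi> x / 2\<close>, both sides are polynomials in \<open>sin\<^sup>2 w\<close>, and their difference factors.
\<close>

lemma sin_sq_three_halves:
  fixes x y :: real
  assumes "0 \<le> x" "3 * x \<le> 2 * y" "y \<le> 1/2"
  shows "4 * (sin (pi * x))\<^sup>2 \<le> 3 * (sin (pi * y))\<^sup>2"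
proof -
  define w where "w = pi * (x / 2)"
  define S where "S = (sin w)\<^sup>2"
  have "S \<le> (sin (pi * (1/6)))\<^sup>2"
    unfolding S_def w_def by (rule sin_sq_mono) (use assms in auto)
  then have S: "0 \<le> S" "S \<le> 1/4" by (auto simp: S_def sin_30 power_divide)
  have "0 \<le> S * ((1/4 - S) * (11/12 - S))" using S by (intro mult_nonneg_nonneg) auto
  moreover have "3 * (S * (3 - 4 * S)\<^sup>2) - 4 * (4 * S * (1 - S)) = 48 * (S * ((1/4 - S) * (11/12 - S)))"
    by (simp add: field_simps power2_eq_square)
  ultimately have "4 * (4 * S * (1 - S)) \<le> 3 * (S * (3 - 4 * S)\<^sup>2)" by linarith
  also have "4 * S * (1 - S) = (sin (2 * w))\<^sup>2"
    by (simp add: S_def sin_double cos_squared_eq power_mult_distrib)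
  also have "2 * w = pi * x" by (simp add: w_def)
  also have "S * (3 - 4 * S)\<^sup>2 = (sin (3 * w))\<^sup>2"
  proof -
    have "sin (3 * w) = sin (2 * w + w)" by simp
    also have "\<dots> = sin w * (3 * (cos w)\<^sup>2 - (sin w)\<^sup>2)"
      unfolding sin_add sin_double cos_double by (simp add: algebra_simps power2_eq_square)
    also have "\<dots> = sin w * (3 - 4 * S)" unfolding S_def cos_squared_eq by simp
    finally show ?thesis by (simp add: power_mult_distrib S_def)
  qed
  also have "(sin (3 * w))\<^sup>2 \<le> (sin (pi * y))\<^sup>2"
    using sin_sq_mono[of "3 * x / 2" y] assms by (simp add: w_def ac_simps)
  finally show ?thesis by simp
qed

lemma sin_sq_diff_int: "(sin (pi * (x - of_int p)))\<^sup>2 = (sin (pi * x))\<^sup>2" for x :: real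
proof -
  have "sin (pi * of_int p) = 0" using sin_zero_iff_int2 by (metis mult.commute)
  moreover from this have "(cos (pi * of_int p))\<^sup>2 = 1" by (simp add: cos_squared_eq)
  ultimately show ?thesis
    by (simp add: right_diff_distrib sin_diff power_mult_distrib)
qed

lemma sin_sq_abs: "(sin (pi * \<bar>x\<bar>))\<^sup>2 = (sin (pi * x))\<^sup>2" for x :: real
  by (simp add: abs_if)

section \<open>Convergents and best approximation\<close>

lemma cf_fin_bounds:
  assumes "\<forall>j\<ge>1. a j \<ge> 1" "1 \<le> k"
  shows "0 \<le> cf_fin a k n \<and> cf_fin a k n \<le> 1"
  using assms(2)
proof (induction n arbitrary: k)
  case (Suc n)
  have "0 \<le> cf_fin a (Suc k) n" using Suc.IH[of "Suc k"] by simp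
  moreover have "1 \<le> real (a k)" using assms(1) Suc.prems by simp
  ultimately show ?case by (simp add: field_simps)
qed simp

locale irrational_cf =
  fixes \<alpha> :: real and a :: "nat \<Rightarrow> nat"
  assumes irrational: "\<alpha> \<notin> \<rat>" and partial_quotients: "has_partial_quotients \<alpha> a"
begin

abbreviation q :: "nat \<Rightarrow> nat" where "q \<equiv> cf_denom a"
abbreviation \<delta> :: "nat \<Rightarrow> real" where "\<delta> \<equiv> delta \<alpha> a"

lemma a_pos: "1 \<le> n \<Longrightarrow> 1 \<le> a n"
  using partial_quotients by (simp add: has_partial_quotients_def)

text \<open>
  The complete quotients: \<open>tail k\<close> is the value of \<open>[a\<^sub>k\<^sub>+\<^sub>1, a\<^sub>k\<^sub>+\<^sub>2, \<dots>]\<close>.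
\<close>

primrec tail :: "nat \<Rightarrow> real" where
  "tail 0 = \<alpha>"
| "tail (Suc k) = 1 / tail k - real (a (Suc k))"

declare tail.simps(2) [simp del]

text \<open>
  Irrationality passes from one tail to the next and excludes the end points 0 and 1 of the
  interval that contains all finite continued fractions.
\<close>

lemma tail_props: "(\<lambda>n. cf_fin a (Suc k) n) \<longlonglongrightarrow> tail k \<and> tail k \<notin> \<rat> \<and> 0 < tail k \<and> tail k < 1"
proof (induction k)
  case 0
  have lim: "(\<lambda>n. cf_fin a (Suc 0) n) \<longlonglongrightarrow> tail 0"
    using partial_quotients by (simp add: has_partial_quotients_def)
  have "0 \<le> tail 0" "tail 0 \<le> 1"
    using LIMSEQ_le_const[OF lim] LIMSEQ_le_const2[OF lim] cf_fin_bounds[of a 1] a_pos by auto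
  moreover have "tail 0 \<noteq> 0" "tail 0 \<noteq> 1" using irrational by auto
  ultimately show ?case using lim irrational by simp
next
  case (Suc k)
  have "(\<lambda>n. cf_fin a (Suc k) (Suc n)) \<longlonglongrightarrow> tail k" using Suc by (blast intro: LIMSEQ_Suc)
  then have "(\<lambda>n. inverse (cf_fin a (Suc k) (Suc n)) - real (a (Suc k)))
      \<longlonglongrightarrow> inverse (tail k) - real (a (Suc k))"
    using Suc by (intro tendsto_intros) auto
  then have lim: "(\<lambda>n. cf_fin a (Suc (Suc k)) n) \<longlonglongrightarrow> tail (Suc k)"
    by (simp add: tail.simps(2) divide_inverse)
  have irr: "tail (Suc k) \<notin> \<rat>"
  proof
    assume "tail (Suc k) \<in> \<rat>"
    then have "1 / (tail (Suc k) + real (a (Suc k))) \<in> \<rat>" by (intro Rats_divide Rats_add) auto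
    then show False using Suc by (simp add: tail.simps(2))
  qed
  have "0 \<le> tail (Suc k)" "tail (Suc k) \<le> 1"
    using LIMSEQ_le_const[OF lim] LIMSEQ_le_const2[OF lim]
      cf_fin_bounds[of a "Suc (Suc k)"] a_pos by auto
  moreover have "tail (Suc k) \<noteq> 0" "tail (Suc k) \<noteq> 1" using irr by (metis Rats_0, metis Rats_1)
  ultimately show ?case using lim irr by simp
qed

lemma tail_pos: "0 < tail k" and tail_less_1: "tail k < 1"
  using tail_props by auto

text \<open>
  The product of the first \<open>n + 1\<close> tails is the unsigned approximation error
  \<open>\<bar>q\<^sub>n \<alpha> - p\<^sub>n\<bar>\<close>; see \<open>err_signed\<close>. In this form positivity and monotonicity are
  immediate.
\<close>

primrec err :: "nat \<Rightarrow> real" where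
  "err 0 = \<alpha>"
| "err (Suc n) = err n * tail (Suc n)"

lemma err_pos: "0 < err n"
  using tail_pos[of 0] by (induction n) (simp_all add: tail_pos)

lemma err_decreasing: "err (Suc n) < err n"
  using err_pos[of n] tail_less_1[of "Suc n"] by simp

lemma err_1: "real (a 1) * \<alpha> + err 1 = 1"
  using tail_pos[of 0] by (simp add: tail.simps(2) field_simps)

lemma err_recurrence: "err n = real (a (Suc (Suc n))) * err (Suc n) + err (Suc (Suc n))"
proof -
  have "tail (Suc n) * (real (a (Suc (Suc n))) + tail (Suc (Suc n))) = 1"
    using tail_pos[of "Suc n"] by (simp add: tail.simps(2)[of "Suc n"])
  then have "err n = err n * (tail (Suc n) * (real (a (Suc (Suc n))) + tail (Suc (Suc n))))" by simp
  then show ?thesis by (simp add: algebra_simps)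
qed

declare err.simps(2) [simp del]

lemma err_sum_le: "err (Suc n) + err (Suc (Suc n)) \<le> err n"
  using err_recurrence[of n] a_pos[of "Suc (Suc n)"] err_pos[of "Suc n"]
    mult_right_mono[of 1 "real (a (Suc (Suc n)))" "err (Suc n)"] by simp

fun numer :: "nat \<Rightarrow> int" where
  "numer 0 = 0"
| "numer (Suc 0) = 1"
| "numer (Suc (Suc n)) = int (a (Suc (Suc n))) * numer (Suc n) + numer n"

lemma err_signed: "real (q n) * \<alpha> - of_int (numer n) = (-1) ^ n * err n"
proof (induction n rule: numer.induct)
  case 2
  then show ?case using err_1 by simp
next
  case (3 n)
  have "real (q (Suc (Suc n))) * \<alpha> - of_int (numer (Suc (Suc n))) =
      real (a (Suc (Suc n))) * (real (q (Suc n)) * \<alpha> - of_int (numer (Suc n)))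
        + (real (q n) * \<alpha> - of_int (numer n))"
    by (simp add: algebra_simps)
  also have "\<dots> = (-1) ^ n * (err n - real (a (Suc (Suc n))) * err (Suc n))"
    unfolding 3 by (simp add: algebra_simps)
  also have "\<dots> = (-1) ^ n * err (Suc (Suc n))" using err_recurrence[of n] by simp
  finally show ?case by simp
qed simp

lemma denom_err: "real (q (Suc n)) * err n + real (q n) * err (Suc n) = 1"
proof (induction n)
  case 0
  then show ?case using err_1 by simp
next
  case (Suc n)
  have "real (q (Suc (Suc n))) * err (Suc n) + real (q (Suc n)) * err (Suc (Suc n)) =
     real (q (Suc n)) * (real (a (Suc (Suc n))) * err (Suc n) + err (Suc (Suc n)))
       + real (q n) * err (Suc n)" by (simp add: algebra_simps)
  then show ?case using Suc err_recurrence[of n] by simp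
qed

lemma numer_denom_det: "numer (Suc n) * int (q n) - numer n * int (q (Suc n)) = (-1) ^ n"
  by (induction n) (simp_all add: algebra_simps)

lemma denom_pos: "1 \<le> q n"
  by (induction n rule: numer.induct) (use a_pos in \<open>auto intro: trans_le_add2\<close>)

lemma denom_recurrence_le: "q (Suc n) + q n \<le> q (Suc (Suc n))"
  using a_pos[of "Suc (Suc n)"] by simp

lemma denom_ge: "n \<le> q n"
proof (induction n rule: numer.induct)
  case (3 n)
  then show ?case using denom_recurrence_le[of n] denom_pos[of n] by linarith
qed (use a_pos in auto)

text \<open>
  The index from which the denominators increase strictly and all errors are at most \<open>1/2\<close>.
  It is 1 exactly for \<open>\<alpha> > 1/2\<close>, where \<open>q\<^sub>0 = q\<^sub>1 = 1\<close> and the error \<open>\<alpha>\<close> of \<open>q\<^sub>0\<close> is not the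
  distance to the nearest integer.
\<close>

definition start :: nat where "start = (if a 1 = 1 then 1 else 0)"

lemma denom_start: "q start = 1"
  by (simp add: start_def)

lemma denom_Suc_less: "start \<le> n \<Longrightarrow> q n < q (Suc n)"
proof (cases n)
  case 0
  assume "start \<le> n"
  then show ?thesis using 0 a_pos[of 1] by (auto simp: start_def split: if_splits)
next
  case (Suc k)
  then show ?thesis using denom_recurrence_le[of k] denom_pos[of k] by (simp del: cf_denom.simps)
qed

lemma denom_less: "start \<le> n \<Longrightarrow> n < m \<Longrightarrow> q n < q m"
  by (rule less_Suc_induct[of n m "\<lambda>i j. start \<le> i \<longrightarrow> q i < q j", THEN mp])
     (auto intro: denom_Suc_less)

lemma denom_mono: "start \<le> n \<Longrightarrow> n \<le> m \<Longrightarrow> q n \<le> q m"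
  using denom_less by (metis le_less)

text \<open>
  The bound \<open>1/2\<close> keeps \<open>\<pi> \<theta>\<^sub>n\<close> in the range where the sine increases, so that slopes are
  ordered like errors.
\<close>

lemma err_le_half: "start \<le> n \<Longrightarrow> err n \<le> 1/2"
proof -
  assume "start \<le> n"
  then have "2 \<le> q (Suc n)" using denom_Suc_less[of n] denom_pos[of n] by simp
  then have "2 * err n \<le> real (q (Suc n)) * err n" using err_pos[of n] by (intro mult_right_mono) auto
  also have "\<dots> \<le> 1" using denom_err[of n] err_pos[of "Suc n"] by (smt (verit) mult_nonneg_nonneg of_nat_0_le_iff)
  finally show ?thesis by simp
qed

lemma delta_err: "\<delta> n = 4 * (sin (pi * err n))\<^sup>2"
proof -
  have "(sin (pi * (real (q n) * \<alpha>)))\<^sup>2 = (sin (pi * ((-1) ^ n * err n)))\<^sup>2"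
    using sin_sq_diff_int[of "real (q n) * \<alpha>" "numer n"] by (simp add: err_signed)
  also have "\<dots> = (sin (pi * err n))\<^sup>2" by (cases "even n") auto
  finally show ?thesis by (simp add: delta_def mult.assoc)
qed

lemma delta_pos: "start \<le> n \<Longrightarrow> 0 < \<delta> n"
  using sin_sq_strict_mono[of 0 "err n"] err_pos[of n] err_le_half[of n] by (simp add: delta_err)

lemma delta_less: "start \<le> n \<Longrightarrow> n < m \<Longrightarrow> \<delta> m < \<delta> n"
proof (rule less_Suc_induct[of n m "\<lambda>i j. start \<le> i \<longrightarrow> \<delta> j < \<delta> i", THEN mp])
  show "start \<le> i \<longrightarrow> \<delta> (Suc i) < \<delta> i" for i
    using sin_sq_strict_mono[of "err (Suc i)" "err i"] err_pos[of "Suc i"] err_decreasing[of i]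
      err_le_half[of i] by (simp add: delta_err)
qed auto

lemma delta_antimono: "start \<le> n \<Longrightarrow> n \<le> m \<Longrightarrow> \<delta> m \<le> \<delta> n"
  using delta_less by (metis le_less)

text \<open>
  Two consecutive convergents form a basis of \<open>\<int>\<^sup>2\<close>. In this basis the coordinates of
  \<open>(i, p)\<close> have opposite signs, or the second one is 0, as \<open>0 < i < q\<^sub>m\<^sub>+\<^sub>1\<close>. The errors of the two convergents also have
  opposite signs, so their contributions to \<open>i \<alpha> - p\<close> add up instead of cancelling.
\<close>

lemma best_approximation:
  assumes i: "1 \<le> i" "i < q (Suc m)"
  shows "err m \<le> \<bar>real i * \<alpha> - of_int p\<bar>"
proof -
  define e :: int where "e = (-1) ^ m"
  define u where "u = e * (int i * numer (Suc m) - p * int (q (Suc m)))"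
  define v where "v = e * (p * int (q m) - int i * numer m)"
  have e2: "e * e = 1" by (simp add: e_def flip: power_add)
  have det: "numer (Suc m) * int (q m) - numer m * int (q (Suc m)) = e"
    using numer_denom_det by (simp add: e_def)
  have "u * int (q m) + v * int (q (Suc m))
      = int i * (e * (numer (Suc m) * int (q m) - numer m * int (q (Suc m))))"
    by (simp add: u_def v_def algebra_simps)
  then have ui: "int i = u * int (q m) + v * int (q (Suc m))" unfolding det e2 by simp
  have "u * numer m + v * numer (Suc m)
      = p * (e * (numer (Suc m) * int (q m) - numer m * int (q (Suc m))))"
    by (simp add: u_def v_def algebra_simps)
  then have up: "p = u * numer m + v * numer (Suc m)" unfolding det e2 by simp
  have "real i = of_int (int i)" by simp
  also have "\<dots> = of_int u * real (q m) + of_int v * real (q (Suc m))" unfolding ui by simp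
  finally have ri: "real i = of_int u * real (q m) + of_int v * real (q (Suc m))" .
  have "real i * \<alpha> - of_int p = of_int u * (real (q m) * \<alpha> - of_int (numer m))
      + of_int v * (real (q (Suc m)) * \<alpha> - of_int (numer (Suc m)))"
    unfolding ri up by (simp add: algebra_simps)
  also have "\<dots> = (-1) ^ m * (of_int u * err m - of_int v * err (Suc m))"
    unfolding err_signed by (simp add: algebra_simps)
  finally have abs: "\<bar>real i * \<alpha> - of_int p\<bar> = \<bar>of_int u * err m - of_int v * err (Suc m)\<bar>"
    by (simp add: abs_mult power_abs)
  have pos: "0 < int (q m)" "0 < int (q (Suc m))"
    using denom_pos[of m] denom_pos[of "Suc m"] by linarith+
  have "1 \<le> u \<and> v \<le> 0 \<or> u \<le> -1 \<and> 0 \<le> v"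
  proof (cases "1 \<le> v")
    case True
    then have "int (q (Suc m)) \<le> v * int (q (Suc m))" using pos by simp
    then have "u * int (q m) < 0" using ui i by linarith
    then have "u < 0" using pos by (simp add: mult_less_0_iff)
    then show ?thesis using True by simp
  next
    case False
    then have "v * int (q (Suc m)) \<le> 0" using pos by (simp add: mult_le_0_iff)
    then have "0 < u * int (q m)" using ui i by linarith
    then have "0 < u" using pos by (simp add: zero_less_mult_iff)
    then show ?thesis using False by simp
  qed
  then show ?thesis
  proof
    assume uv: "1 \<le> u \<and> v \<le> 0"
    have "1 * err m \<le> of_int u * err m" using uv err_pos[of m] by (intro mult_right_mono) auto
    moreover have "of_int v * err (Suc m) \<le> 0"
      using uv err_pos[of "Suc m"] by (intro mult_nonpos_nonneg) auto
    ultimately show ?thesis unfolding abs by linarith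
  next
    assume uv: "u \<le> -1 \<and> 0 \<le> v"
    have "of_int u * err m \<le> (-1) * err m" using uv err_pos[of m] by (intro mult_right_mono) auto
    moreover have "0 \<le> of_int v * err (Suc m)"
      using uv err_pos[of "Suc m"] by (intro mult_nonneg_nonneg) auto
    ultimately show ?thesis unfolding abs by linarith
  qed
qed

lemma delta_le_sin_sq:
  assumes "1 \<le> i" "i < q (Suc m)"
  shows "\<delta> m \<le> 4 * (sin (pi * real i * \<alpha>))\<^sup>2"
proof -
  define y where "y = \<bar>real i * \<alpha> - of_int (round (real i * \<alpha>))\<bar>"
  have "y \<le> 1/2" unfolding y_def using of_int_round_abs_le[of "real i * \<alpha>"] by (simp add: abs_minus_commute)
  moreover have "err m \<le> y" unfolding y_def by (rule best_approximation[OF assms])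
  ultimately have "(sin (pi * err m))\<^sup>2 \<le> (sin (pi * y))\<^sup>2"
    using err_pos[of m] by (intro sin_sq_mono) auto
  also have "\<dots> = (sin (pi * real i * \<alpha>))\<^sup>2"
    unfolding y_def sin_sq_abs sin_sq_diff_int by (simp add: mult.assoc)
  finally show ?thesis by (simp add: delta_err)
qed

text \<open>
  With \<open>delta_le_sin_sq\<close>, this gives every index a convergent denominator whose line has both
  a smaller slope and a smaller intercept, in the weak sense.
\<close>

lemma denom_bracket:
  assumes "1 \<le> i"
  obtains m where "start \<le> m" "q m \<le> i" "i < q (Suc m)"
proof -
  define M where "M = (LEAST M. start \<le> M \<and> i < q M)"
  have ex: "start \<le> start + Suc i \<and> i < q (start + Suc i)"
    using denom_ge[of "start + Suc i"] by simp
  have M: "start \<le> M \<and> i < q M" unfolding M_def by (rule LeastI[of _ "start + Suc i"]) (rule ex)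
  have "M \<noteq> start" using M denom_start assms by auto
  then obtain m where m: "M = Suc m" "start \<le> m" using M by (cases M) auto
  then have "\<not> i < q m" using not_less_Least[of m "\<lambda>M. start \<le> M \<and> i < q M"] M_def by auto
  then show ?thesis using that m M by auto
qed

section \<open>Crossings of the lines of the convergent denominators\<close>

text \<open>
  The squared coordinate \<open>r\<^sub>k\<^sub>,\<^sub>m\<^sup>2\<close>, which is where the two lines meet in the variable \<open>s\<close>.
\<close>

definition crossing_sq :: "nat \<Rightarrow> nat \<Rightarrow> real" where
  "crossing_sq k m = ((real (q m))\<^sup>2 - (real (q k))\<^sup>2) / (\<delta> k - \<delta> m)"

lemma denom_sq_less: "start \<le> k \<Longrightarrow> k < m \<Longrightarrow> (real (q k))\<^sup>2 < (real (q m))\<^sup>2"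
  using denom_less[of k m] by (simp add: power_strict_mono)

lemma crossing_sq_pos: "start \<le> k \<Longrightarrow> k < m \<Longrightarrow> 0 < crossing_sq k m"
  unfolding crossing_sq_def using denom_sq_less[of k m] delta_less[of k m] by simp

lemma later_line_above_iff:
  assumes "start \<le> k" "k < m"
  shows "\<delta> k * s + (real (q k))\<^sup>2 \<le> \<delta> m * s + (real (q m))\<^sup>2 \<longleftrightarrow> s \<le> crossing_sq k m"
  unfolding crossing_sq_def using delta_less[OF assms] by (simp add: pos_le_divide_eq algebra_simps)

lemma earlier_line_above_iff:
  assumes "start \<le> k" "k < m"
  shows "\<delta> m * s + (real (q m))\<^sup>2 \<le> \<delta> k * s + (real (q k))\<^sup>2 \<longleftrightarrow> crossing_sq k m \<le> s"
  unfolding crossing_sq_def using delta_less[OF assms] by (simp add: pos_divide_le_eq algebra_simps)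

text \<open>
  The crossing of the outer lines is the mediant of the other two crossings. Consequently,
  fairness of a triple amounts to one inequality, and a line that is convexly placed between two
  others shields each of them from the other one.
\<close>

lemma crossing_sq_mediant:
  assumes "start \<le> k" "k < n" "n < m" "crossing_sq k n < crossing_sq n m"
  shows "crossing_sq k n < crossing_sq k m" "crossing_sq k m < crossing_sq n m"
proof -
  have d: "0 < \<delta> k - \<delta> n" "0 < \<delta> n - \<delta> m" "0 < \<delta> k - \<delta> m"
    using delta_less[of k n] delta_less[of n m] assms by auto
  have *: "crossing_sq k n * (\<delta> k - \<delta> n) = (real (q n))\<^sup>2 - (real (q k))\<^sup>2"
    "crossing_sq n m * (\<delta> n - \<delta> m) = (real (q m))\<^sup>2 - (real (q n))\<^sup>2"
    using d by (simp_all add: crossing_sq_def)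
  have **: "crossing_sq k m = (crossing_sq k n * (\<delta> k - \<delta> n) + crossing_sq n m * (\<delta> n - \<delta> m)) / (\<delta> k - \<delta> m)"
    unfolding * by (simp add: crossing_sq_def)
  have "crossing_sq k n * (\<delta> n - \<delta> m) < crossing_sq n m * (\<delta> n - \<delta> m)" "crossing_sq k n * (\<delta> k - \<delta> n) < crossing_sq n m * (\<delta> k - \<delta> n)"
    using d assms(4) by auto
  then show "crossing_sq k n < crossing_sq k m" "crossing_sq k m < crossing_sq n m"
    unfolding ** using d by (simp_all add: pos_less_divide_eq pos_divide_less_eq algebra_simps)
qed

text \<open>
  Dropping \<open>q\<^sub>k\<^sup>2\<close> from the left-hand fraction and \<open>\<delta>\<^sub>m\<close> from the right-hand one decouples
  the two sides: \<open>c q\<^sub>n\<^sup>2 / \<delta>\<^sub>n\<close> separates the crossings. Here \<open>c\<close> measures the jump of the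
  squared denominators after \<open>n\<close>, and the larger it is, the smaller a drop of the slopes before
  \<open>n\<close> suffices.
\<close>

lemma crossing_sq_less_criterion:
  assumes k: "start \<le> k" "k < n" "n < m"
    and c: "(1 + c) * (real (q n))\<^sup>2 \<le> (real (q m))\<^sup>2" "(1 + c) * \<delta> n \<le> c * \<delta> k"
  shows "crossing_sq k n < crossing_sq n m"
proof -
  define Q where "Q = (real (q n))\<^sup>2"
  have d: "0 < \<delta> n" "0 < \<delta> k - \<delta> n" "0 < \<delta> n - \<delta> m" "\<delta> n - \<delta> m \<le> \<delta> n"
    using delta_less[of k n] delta_less[of n m] delta_pos[of n] delta_pos[of m] k by auto
  have Qk: "0 < (real (q k))\<^sup>2" using denom_pos[of k] by simp
  then have Q: "0 < Q" "Q < (real (q m))\<^sup>2"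
    using denom_sq_less[of k n] denom_sq_less[of n m] denom_pos[of n] k by (auto simp: Q_def)
  have "crossing_sq k n < Q / (\<delta> k - \<delta> n)"
    unfolding crossing_sq_def using Qk d by (simp add: Q_def divide_strict_right_mono)
  also have "\<dots> \<le> c * Q / \<delta> n"
  proof -
    have "Q * \<delta> n \<le> Q * (c * (\<delta> k - \<delta> n))" using Q c(2) by (intro mult_left_mono) (auto simp: algebra_simps)
    then show ?thesis using d by (simp add: divide_simps algebra_simps)
  qed
  also have "\<dots> \<le> ((real (q m))\<^sup>2 - Q) / \<delta> n"
    using c(1) d by (intro divide_right_mono) (auto simp: Q_def algebra_simps)
  also have "\<dots> \<le> ((real (q m))\<^sup>2 - Q) / (\<delta> n - \<delta> m)"
    using Q d by (intro divide_left_mono mult_pos_pos) auto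
  finally show ?thesis by (simp add: crossing_sq_def Q_def)
qed

lemma crossing_sq_less_of_doubling:
  assumes k: "start \<le> k" "k < n" "n < m"
    and "2 * q n \<le> q m" "4 * \<delta> n \<le> 3 * \<delta> k"
  shows "crossing_sq k n < crossing_sq n m"
proof (rule crossing_sq_less_criterion[OF k, of 3])
  have "(2 * real (q n))\<^sup>2 \<le> (real (q m))\<^sup>2" using assms(4) by (intro power_mono) linarith+
  then show "(1 + 3) * (real (q n))\<^sup>2 \<le> (real (q m))\<^sup>2" by (simp add: power_mult_distrib)
qed (use assms(5) in simp)

lemma convex_of_large_quotient:
  assumes k: "start \<le> k" "k < n" "n < m" and a: "2 \<le> a (Suc n)"
  shows "crossing_sq k n < crossing_sq n m"
proof (rule crossing_sq_less_of_doubling[OF k])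
  obtain j where j: "n = Suc j" "k \<le> j" using k by (cases n) auto
  have "2 * q n \<le> a (Suc n) * q n" using a by simp
  also have "\<dots> \<le> q (Suc n)" by (simp add: j)
  also have "\<dots> \<le> q m" using k by (intro denom_mono) auto
  finally show "2 * q n \<le> q m" .
  have "2 * err n \<le> real (a (Suc n)) * err n" using a err_pos[of n] by (intro mult_right_mono) auto
  also have "\<dots> \<le> err j" using err_recurrence[of j] err_pos[of "Suc n"] by (simp add: j)
  finally have "2 * \<delta> n \<le> \<delta> j"
    using sin_sq_double[of "err n" "err j"] err_pos[of n] err_le_half[of j] k j by (simp add: delta_err)
  also have "\<dots> \<le> \<delta> k" using k j by (intro delta_antimono) auto
  finally show "4 * \<delta> n \<le> 3 * \<delta> k" using delta_pos[of n] k by simp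
qed

text \<open>
  The hypothesis controls the immediate neighbours only. The later index is moved away from
  \<open>n + 1\<close> first, with the earlier one kept at \<open>n - 1\<close>; then the earlier index is moved.
\<close>

lemma convex_of_adjacent:
  assumes k: "start \<le> k" "k < n" "n < m" and adj: "crossing_sq (n - 1) n < crossing_sq n (Suc n)"
  shows "crossing_sq k n < crossing_sq n m"
proof -
  obtain j where j: "n = Suc j" "k \<le> j" "start \<le> j" using k by (cases n) auto
  have step1: "crossing_sq j n < crossing_sq n m"
  proof (cases "m = Suc n")
    case True
    then show ?thesis using adj j by simp
  next
    case False
    then have m: "Suc n < m" using k by simp
    \<comment> \<open>Either the line of \<open>n + 1\<close> shields the line of \<open>n\<close> from later ones, or the error drops
      slowly after \<open>n\<close>, which makes the drop before \<open>n\<close> large.\<close>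
    show ?thesis
    proof (cases "2 \<le> a (Suc (Suc n))")
      case True
      then have "crossing_sq n (Suc n) < crossing_sq (Suc n) m"
        using m j by (intro convex_of_large_quotient) auto
      then have "crossing_sq n (Suc n) < crossing_sq n m"
        using m j by (intro crossing_sq_mediant) auto
      then show ?thesis using adj j by simp
    next
      case False
      then have a1: "a (Suc (Suc n)) = 1" using a_pos[of "Suc (Suc n)"] by simp
      show ?thesis
      proof (rule crossing_sq_less_of_doubling)
        have "2 * q n \<le> q (Suc (Suc n))"
          using denom_recurrence_le[of n] denom_mono[of n "Suc n"] j by (simp del: cf_denom.simps)
        also have "\<dots> \<le> q m" using m j by (intro denom_mono) auto
        finally show "2 * q n \<le> q m" .
        have "3 * err n \<le> 2 * err j"
          using err_recurrence[of n] a1 err_sum_le[of j] err_decreasing[of "Suc n"]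
          by (simp add: j)
        then show "4 * \<delta> n \<le> 3 * \<delta> j"
          using sin_sq_three_halves[of "err n" "err j"] err_pos[of n] err_le_half[of j] j
          by (simp add: delta_err)
      qed (use k j in auto)
    qed
  qed
  show ?thesis
  proof (cases "k = j")
    case True
    then show ?thesis using step1 by simp
  next
    case False
    then obtain l where l: "j = Suc l" "k \<le> l" "start \<le> l" using j k by (cases j) auto
    \<comment> \<open>Either the line of \<open>n - 1\<close> shields the line of \<open>n\<close> from earlier ones, or \<open>q\<^sub>n\<^sub>-\<^sub>1\<close> is at least
      half of \<open>q\<^sub>n\<close>, which makes the step from \<open>q\<^sub>n\<close> to \<open>q\<^sub>n\<^sub>+\<^sub>1\<close> large.\<close>
    show ?thesis
    proof (cases "2 \<le> a n")
      case True
      then have "crossing_sq k j < crossing_sq j n" using k j l False by (intro convex_of_large_quotient) auto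
      then have "crossing_sq k n < crossing_sq j n" using k j l False by (intro crossing_sq_mediant) auto
      then show ?thesis using step1 by simp
    next
      case False
      then have a1: "a (Suc (Suc l)) = 1" using a_pos[of n] j l by simp
      show ?thesis
        \<comment> \<open>The denominator grows by a factor \<open>3/2\<close>, and \<open>(3/2)\<^sup>2 = 1 + 5/4\<close>.\<close>
      proof (rule crossing_sq_less_criterion[OF k, of "5/4"])
        have "q n = q j + q l" using a1 j l by simp
        then have "q n \<le> 2 * q j" using denom_mono[of l j] l by simp
        moreover have "q n + q j \<le> q (Suc n)" using denom_recurrence_le[of j] j by simp
        moreover have "q (Suc n) \<le> q m" using k by (intro denom_mono) auto
        ultimately have "3/2 * real (q n) \<le> real (q m)" by linarith
        then have "(3/2 * real (q n))\<^sup>2 \<le> (real (q m))\<^sup>2" by (intro power_mono) auto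
        then show "(1 + 5/4) * (real (q n))\<^sup>2 \<le> (real (q m))\<^sup>2"
          by (simp add: power_mult_distrib power_divide)
        have "2 * err n \<le> err l"
          using err_sum_le[of l] err_decreasing[of j] j l by simp
        then have "2 * \<delta> n \<le> \<delta> l"
          using sin_sq_double[of "err n" "err l"] err_pos[of n] err_le_half[of l] l
          by (simp add: delta_err)
        also have "\<dots> \<le> \<delta> k" using k l by (intro delta_antimono) auto
        finally show "(1 + 5/4) * \<delta> n \<le> 5/4 * \<delta> k" using delta_pos[of n] k by simp
      qed
    qed
  qed
qed

end

section \<open>Presence and the lower envelope\<close>

lemma c_eps_pos: "0 < \<epsilon> \<Longrightarrow> 0 < c_eps \<epsilon>"
  using cosh_real_ge_1[of \<epsilon>] cosh_real_one_iff[of \<epsilon>] by (simp add: c_eps_def less_le)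

lemma u_fun_le_iff:
  assumes "0 < \<epsilon>"
  shows "u_fun \<epsilon> \<alpha> i r \<le> u_fun \<epsilon> \<alpha> j r \<longleftrightarrow>
    4 * (sin (pi * real i * \<alpha>))\<^sup>2 * r\<^sup>2 + (real i)\<^sup>2 \<le> 4 * (sin (pi * real j * \<alpha>))\<^sup>2 * r\<^sup>2 + (real j)\<^sup>2"
  using c_eps_pos[OF assms] by (simp add: u_fun_def)

lemma u_fun_eq_B_fun_iff:
  assumes "0 < \<epsilon>" "1 \<le> j"
  shows "u_fun \<epsilon> \<alpha> j r = B_fun \<epsilon> \<alpha> r \<longleftrightarrow> (\<forall>i\<ge>1. u_fun \<epsilon> \<alpha> j r \<le> u_fun \<epsilon> \<alpha> i r)"
proof -
  have "\<And>i. 0 \<le> u_fun \<epsilon> \<alpha> i r"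
    using c_eps_pos[OF assms(1)] by (simp add: u_fun_def)
  then have bdd: "bdd_below ((\<lambda>i. u_fun \<epsilon> \<alpha> i r) ` {1..})" by (intro bdd_belowI2[of _ 0]) auto
  show ?thesis
  proof
    assume "u_fun \<epsilon> \<alpha> j r = B_fun \<epsilon> \<alpha> r"
    then show "\<forall>i\<ge>1. u_fun \<epsilon> \<alpha> j r \<le> u_fun \<epsilon> \<alpha> i r"
      unfolding B_fun_def using cINF_lower[OF bdd] by auto
  next
    assume "\<forall>i\<ge>1. u_fun \<epsilon> \<alpha> j r \<le> u_fun \<epsilon> \<alpha> i r"
    then have "u_fun \<epsilon> \<alpha> j r \<le> B_fun \<epsilon> \<alpha> r"
      unfolding B_fun_def by (intro cINF_greatest) auto
    moreover have "B_fun \<epsilon> \<alpha> r \<le> u_fun \<epsilon> \<alpha> j r"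
      unfolding B_fun_def using assms(2) by (intro cINF_lower[OF bdd]) auto
    ultimately show "u_fun \<epsilon> \<alpha> j r = B_fun \<epsilon> \<alpha> r" by simp
  qed
qed

context irrational_cf
begin

text \<open>
  The interval in the variable \<open>s\<close> runs from the last crossing with an earlier line to the
  first crossing with a later one, but at most to \<open>L + 1\<close>. Beyond a certain index, later lines
  have an intercept so large that they stay above the line of \<open>q\<^sub>n\<close> up to \<open>L + 1\<close>.
  Therefore only finitely many later lines bound the interval.
\<close>

lemma presentI:
  assumes "0 < \<epsilon>" and n: "start \<le> n"
    and conv: "\<And>k m. start \<le> k \<Longrightarrow> k < n \<Longrightarrow> n < m \<Longrightarrow> crossing_sq k n < crossing_sq n m"
  shows "present \<epsilon> \<alpha> (q n)"
proof -
  \<comment> \<open>The value 0 covers the case without earlier lines and keeps the interval in \<open>s \<ge> 0\<close>.\<close>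
  define K where "K = insert 0 ((\<lambda>k. crossing_sq k n) ` {start..<n})"
  define L where "L = Max K"
  have fin: "finite K" "K \<noteq> {}" by (auto simp: K_def)
  have L0: "0 \<le> L" unfolding L_def using fin by (intro Max_ge) (auto simp: K_def)
  have LR: "crossing_sq k n \<le> L" if "start \<le> k" "k < n" for k
    unfolding L_def using fin that by (intro Max_ge) (auto simp: K_def)
  have LR': "L < crossing_sq n m" if "n < m" for m
  proof -
    have "L \<in> K" unfolding L_def using fin by (rule Max_in)
    then show ?thesis using conv crossing_sq_pos[OF n that] that by (auto simp: K_def)
  qed
  define C where "C = \<delta> n * (L + 1) + (real (q n))\<^sup>2"
  \<comment> \<open>Since \<open>m \<le> q\<^sub>m \<le> q\<^sub>m\<^sup>2\<close>, the intercepts from index \<open>N\<close> on reach the height \<open>C\<close> of the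
    line of \<open>q\<^sub>n\<close> at \<open>L + 1\<close>.\<close>
  obtain N :: nat where N: "C \<le> real N" using real_arch_simple by blast
  define T where "T = insert (L + 1) ((\<lambda>m. crossing_sq n m) ` {n<..<Suc n + N})"
  define t where "t = Min T"
  have finT: "finite T" "T \<noteq> {}" by (auto simp: T_def)
  have "t \<in> T" unfolding t_def using finT by (rule Min_in)
  then have Lt: "L < t" using LR' by (auto simp: T_def)
  have t1: "t \<le> L + 1" unfolding t_def using finT by (intro Min_le) (auto simp: T_def)
  have tR: "t \<le> crossing_sq n m" if "n < m" for m
  proof (cases "m < Suc n + N")
    case True
    then show ?thesis unfolding t_def using finT that by (intro Min_le) (auto simp: T_def)
  next
    case False
    then have m: "C \<le> real (q m)" using denom_ge[of m] N by linarith
    have "real (q m) * 1 \<le> real (q m) * real (q m)"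
      using denom_pos[of m] by (intro mult_left_mono) auto
    then have "real (q m) \<le> (real (q m))\<^sup>2" by (simp add: power2_eq_square)
    moreover have "0 \<le> \<delta> m * (L + 1)" using delta_pos[of m] n that L0 by (intro mult_nonneg_nonneg) auto
    ultimately have "\<delta> n * (L + 1) + (real (q n))\<^sup>2 \<le> \<delta> m * (L + 1) + (real (q m))\<^sup>2"
      using m unfolding C_def by linarith
    then have "L + 1 \<le> crossing_sq n m" using later_line_above_iff[OF n that] by simp
    then show ?thesis using t1 by simp
  qed
  have le: "u_fun \<epsilon> \<alpha> (q n) r \<le> u_fun \<epsilon> \<alpha> i r" if r: "r \<in> {sqrt L<..<sqrt t}" and i: "1 \<le> i" for r i
  proof -
    have "0 \<le> sqrt L" using L0 by simp
    then have r0: "0 \<le> r" using r unfolding greaterThanLessThan_iff by linarith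
    have "r\<^sup>2 \<le> (sqrt t)\<^sup>2" using r r0 by (intro power_mono) auto
    then have s: "L \<le> r\<^sup>2" "r\<^sup>2 \<le> t" using L0 Lt r sqrt_le_D[of L r] by auto
    obtain m where m: "start \<le> m" "q m \<le> i" "i < q (Suc m)" using denom_bracket[OF i] .
    have "\<delta> n * r\<^sup>2 + (real (q n))\<^sup>2 \<le> \<delta> m * r\<^sup>2 + (real (q m))\<^sup>2"
    proof (cases m n rule: linorder_cases)
      case less
      then show ?thesis using earlier_line_above_iff[OF m(1) less] LR[OF m(1) less] s by simp
    next
      case greater
      then show ?thesis using later_line_above_iff[OF n greater] tR[OF greater] s by simp
    qed simp
    also have "\<dots> \<le> 4 * (sin (pi * real i * \<alpha>))\<^sup>2 * r\<^sup>2 + (real i)\<^sup>2"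
      using delta_le_sin_sq[OF i m(3)] m(2) by (intro add_mono mult_right_mono power_mono) auto
    finally show ?thesis unfolding u_fun_le_iff[OF assms(1)] by (simp add: delta_def)
  qed
  show ?thesis unfolding present_def
  proof (intro conjI exI ballI)
    show "0 \<le> sqrt L" "sqrt L < sqrt t" using L0 Lt by auto
  qed (use le denom_pos[of n] u_fun_eq_B_fun_iff[OF assms(1) denom_pos] in auto)
qed

lemma presentD:
  assumes "0 < \<epsilon>" and km: "start \<le> k" "k < n" "n < m" and "present \<epsilon> \<alpha> (q n)"
  shows "crossing_sq k n < crossing_sq n m"
proof -
  obtain s t where st: "0 \<le> s" "s < t" "\<And>r. r \<in> {s<..<t} \<Longrightarrow> u_fun \<epsilon> \<alpha> (q n) r = B_fun \<epsilon> \<alpha> r"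
    using assms(5) unfolding present_def by blast
  have *: "crossing_sq k n \<le> r\<^sup>2 \<and> r\<^sup>2 \<le> crossing_sq n m" if "r \<in> {s<..<t}" for r
  proof -
    have "u_fun \<epsilon> \<alpha> (q n) r \<le> u_fun \<epsilon> \<alpha> (q l) r" for l
      using st(3)[OF that] u_fun_eq_B_fun_iff[OF assms(1) denom_pos] denom_pos[of l] by blast
    then have "\<delta> n * r\<^sup>2 + (real (q n))\<^sup>2 \<le> \<delta> l * r\<^sup>2 + (real (q l))\<^sup>2" for l
      unfolding u_fun_le_iff[OF assms(1)] delta_def by simp
    then show ?thesis using earlier_line_above_iff[OF km(1,2)] later_line_above_iff[of n m] km by auto
  qed
  \<comment> \<open>Two distinct points of the interval are needed to separate the crossings strictly.\<close>
  obtain x where x: "s < x" "x < t" using dense st(2) by blast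
  obtain y where y: "x < y" "y < t" using dense x(2) by blast
  have "x\<^sup>2 < y\<^sup>2" using x y st(1) by (intro power_strict_mono) auto
  then show ?thesis using *[of x] *[of y] x y by auto
qed

lemma half_less_iff: "1/2 < \<alpha> \<longleftrightarrow> a 1 = 1"
proof
  assume "1/2 < \<alpha>"
  show "a 1 = 1"
  proof (rule ccontr)
    assume "a 1 \<noteq> 1"
    then have "2 * \<alpha> \<le> real (a 1) * \<alpha>" using a_pos[of 1] tail_pos[of 0] by (intro mult_right_mono) auto
    then show False using err_1 err_pos[of 1] \<open>1/2 < \<alpha>\<close> by linarith
  qed
next
  assume "a 1 = 1"
  then show "1/2 < \<alpha>" using err_1 err_decreasing[of 0] by simp
qed

lemma crossing_eq_sqrt:
  assumes "0 < \<epsilon>" "start \<le> k" "k < m"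
  shows "crossing \<epsilon> \<alpha> a k m = sqrt (crossing_sq k m)"
  unfolding crossing_sq_def using assms half_less_iff denom_less[of k m] delta_less[of k m]
  by (intro crossing_eq) (auto simp: start_def split: if_splits)

lemma fair_iff_crossing_sq:
  assumes "0 < \<epsilon>" "start \<le> k" "k < n" "n < m"
  shows "fair \<epsilon> \<alpha> a k n m \<longleftrightarrow> crossing_sq k n < crossing_sq n m"
proof -
  have "\<not> (1/2 < \<alpha> \<and> k = 0)" using half_less_iff assms(2) by (auto simp: start_def)
  then have "fair \<epsilon> \<alpha> a k n m \<longleftrightarrow> crossing_sq k n < crossing_sq k m \<and> crossing_sq k m < crossing_sq n m"
    unfolding fair_def using assms denom_less[of k n] denom_less[of n m]
    by (auto simp: crossing_eq_sqrt)
  then show ?thesis using crossing_sq_mediant[of k n m] assms by auto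
qed

end

theorem corollary3p8:
  fixes \<alpha> \<epsilon> :: real and a :: "nat \<Rightarrow> nat" and n :: nat
  assumes "0 < \<epsilon>" and "\<epsilon> \<le> margulis_constant"
    and "0 < \<alpha>" and "\<alpha> < 1" and "\<alpha> \<notin> \<rat>"
    and "has_partial_quotients \<alpha> a"
    and "1 \<le> n"
  shows "present \<epsilon> \<alpha> (cf_denom a n) \<longleftrightarrow>
           2 \<le> a (n + 1) \<or> fair \<epsilon> \<alpha> a (n - 1) n (n + 1)"
proof -
  interpret irrational_cf \<alpha> a by unfold_locales (rule assms)+
  have start: "start \<le> n" using assms(7) by (simp add: start_def)
  show ?thesis
  proof (cases "n = start")
    \<comment> \<open>This happens only for \<open>n = 1\<close> and \<open>\<alpha> > 1/2\<close>: there is no earlier line, and the triple is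
      fair by convention.\<close>
    case True
    then have n: "n = 1" "1/2 < \<alpha>" using assms(7) half_less_iff by (auto simp: start_def split: if_splits)
    then have "fair \<epsilon> \<alpha> a (n - 1) n (n + 1)" by (simp add: fair_def)
    moreover have "present \<epsilon> \<alpha> (q n)" using assms(1) start True by (intro presentI) auto
    ultimately show ?thesis by simp
  next
    case False
    then have n: "start \<le> n - 1" "n - 1 < n" "n < n + 1" using start by auto
    have fair: "fair \<epsilon> \<alpha> a (n - 1) n (n + 1) \<longleftrightarrow> crossing_sq (n - 1) n < crossing_sq n (n + 1)"
      by (rule fair_iff_crossing_sq[OF assms(1) n])
    show ?thesis
    proof
      assume "present \<epsilon> \<alpha> (q n)"
      then show "2 \<le> a (n + 1) \<or> fair \<epsilon> \<alpha> a (n - 1) n (n + 1)"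
        unfolding fair using presentD[OF assms(1) n] by blast
    next
      assume "2 \<le> a (n + 1) \<or> fair \<epsilon> \<alpha> a (n - 1) n (n + 1)"
      then show "present \<epsilon> \<alpha> (q n)" unfolding fair
        using convex_of_large_quotient convex_of_adjacent
        by (intro presentI[OF assms(1) start]) auto
    qed
  qed
qed

end
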